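(* For all $n=1,2,\ldots$ one has $$\widehat{s}(n) \leq s(n),$$ where $s(n)$ is the optimal expected length of an increasing subsequence selected sequentially from a uniformly random permutation of $\{1,\dots,n\}$, and $\widehat{s}(n)$ is the optimal expected length of an increasing subsequence selected sequentially from $n$ independent random variables uniformly distributed on $[0,1]$.
   Context: Permutation problem: Let $\pi$ be a uniformly distributed random permutation of $\{1,\dots,n\}$, and let $\mathcal{F}_k = \sigma\{\pi[1],\dots,\pi[k]\}$ for $1\le k\le n$. A feasible selection strategy $\boldsymbol{\tau}$ is a sequence $\tau_1<\tau_2<\cdots$ of stopping times with respect to $(\mathcal{F}_k)_{1\le k\le n}$ (with values in $\{1,\dots,n\}\cup\{\infty\}$, strictly increasing as long as they are finite; $\tau_j=\infty$ means no $j$-th selection is made). For such a strategy put $$L^{\boldsymbol{\tau}}_n=\max\{k: \pi[\tau_1] < \pi[\tau_2]< \cdots < \pi[\tau_k], \ 1\leq \tau_1< \tau_2 <\cdots < \tau_k \leq n \}$$ (with value $0$ if no selection is made), and define $s(n) = \sup_{\boldsymbol{\tau}} \mathbb{E}[L^{\boldsymbol{\tau}}_n]$, the supremum being over all such feasible selection strategies. Independent-sequence problem: Let $X_1,\dots,X_n$ be independent and uniformly distributed on $[0,1]$, and let $\widehat{\mathcal{F}}_k=\sigma\{X_1,\dots,X_k\}$ for $1\le k\le n$. A feasible selection strategy $\boldsymbol{\tau}$ is now a sequence $\tau_1<\tau_2<\cdots$ of stopping times (with the same conventions) with respect to $(\widehat{\mathcal{F}}_k)_{1\le k\le n}$. Put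 $$\widehat{L}^{\boldsymbol{\tau}}_n=\max\{k: X_{\tau_1} < X_{\tau_2}< \cdots < X_{\tau_k}, \ 1\leq \tau_1< \tau_2 <\cdots < \tau_k \leq n \}$$ (with value $0$ if no selection is made), and define $\widehat{s}(n) = \sup_{\boldsymbol{\tau}} \mathbb{E}[\widehat{L}^{\boldsymbol{\tau}}_n]$, the supremum being over all such feasible selection strategies. *)

theory Defs
  imports "HOL-Probability.Probability" "HOL-Probability.Stopping_Time"
    "HOL-Combinatorics.Permutations" "HOL-Library.Extended_Nat"
begin

definition uniform_random_permutation ::
    "'a measure \<Rightarrow> nat \<Rightarrow> ('a \<Rightarrow> nat \<Rightarrow> nat) \<Rightarrow> bool" where
  "uniform_random_permutation M n \<pi> \<longleftrightarrow>
     prob_space M \<and>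
     \<pi> \<in> M \<rightarrow>\<^sub>M count_space {p. p permutes {1..n}} \<and>
     distr M (count_space {p. p permutes {1..n}}) \<pi> = uniform_count_measure {p. p permutes {1..n}}"

definition iid_uniform01 ::
    "'a measure \<Rightarrow> nat \<Rightarrow> (nat \<Rightarrow> 'a \<Rightarrow> real) \<Rightarrow> bool" where
  "iid_uniform01 M n X \<longleftrightarrow>
     prob_space M \<and>
     prob_space.indep_vars M (\<lambda>_. borel) X {1..n} \<and>
     (\<forall>i\<in>{1..n}. distr M borel (X i) = uniform_measure lborel {0..1})"

(* The notions below serve both problems: Y 1, ..., Y n are the observations on M, with values
   in the measurable space S. *)

(* The sigma-algebra generated by Y 1, ..., Y k. Times range over enat so that a stopping time
   may be infinite; the filtration is trivial at time 0 and constant from time n on. *)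
definition natural_filtration ::
    "'a measure \<Rightarrow> 'v measure \<Rightarrow> nat \<Rightarrow> (nat \<Rightarrow> 'a \<Rightarrow> 'v) \<Rightarrow> enat \<Rightarrow> 'a measure" where
  "natural_filtration M S n Y k =
     sigma (space M) {Y i -` A \<inter> space M | i A. i \<in> {1..n} \<and> enat i \<le> k \<and> A \<in> sets S}"

(* The j-th selection (j = 1, 2, ...) is made at time \<tau> j; the value \<infinity> means that it is not
   made, and then no later one is made either. *)
definition selection_strategy ::
    "'a measure \<Rightarrow> 'v measure \<Rightarrow> nat \<Rightarrow> (nat \<Rightarrow> 'a \<Rightarrow> 'v) \<Rightarrow> (nat \<Rightarrow> 'a \<Rightarrow> enat) \<Rightarrow> bool" where
  "selection_strategy M S n Y \<tau> \<longleftrightarrow>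
     (\<forall>j\<ge>1. stopping_time (natural_filtration M S n Y) (\<tau> j)) \<and>
     (\<forall>j\<ge>1. \<forall>\<omega>\<in>space M. \<tau> j \<omega> \<in> enat ` {1..n} \<union> {\<infinity>}) \<and>
     (\<forall>j\<ge>1. \<forall>\<omega>\<in>space M.
        (\<tau> j \<omega> \<noteq> \<infinity> \<longrightarrow> \<tau> j \<omega> < \<tau> (Suc j) \<omega>) \<and> (\<tau> j \<omega> = \<infinity> \<longrightarrow> \<tau> (Suc j) \<omega> = \<infinity>))"

(* k = 0 always qualifies, so the value is 0 if no selection is made. *)
definition selected_length ::
    "nat \<Rightarrow> (nat \<Rightarrow> 'a \<Rightarrow> 'v::linorder) \<Rightarrow> (nat \<Rightarrow> 'a \<Rightarrow> enat) \<Rightarrow> 'a \<Rightarrow> nat" where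
  "selected_length n Y \<tau> \<omega> =
     Max {k. (\<forall>j\<in>{1..k}. 1 \<le> \<tau> j \<omega> \<and> \<tau> j \<omega> \<le> enat n) \<and>
             (\<forall>j\<in>{1..<k}. \<tau> j \<omega> < \<tau> (Suc j) \<omega>) \<and>
             (\<forall>j\<in>{1..<k}. Y (the_enat (\<tau> j \<omega>)) \<omega> < Y (the_enat (\<tau> (Suc j) \<omega>)) \<omega>)}"

definition optimal_expected_length ::
    "'a measure \<Rightarrow> 'v::linorder measure \<Rightarrow> nat \<Rightarrow> (nat \<Rightarrow> 'a \<Rightarrow> 'v) \<Rightarrow> real" where
  "optimal_expected_length M S n Y =
     (SUP \<tau> \<in> {\<tau>. selection_strategy M S n Y \<tau>}.
        prob_space.expectation M (\<lambda>\<omega>. real (selected_length n Y \<tau> \<omega>)))"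

definition s_perm :: "'a measure \<Rightarrow> nat \<Rightarrow> ('a \<Rightarrow> nat \<Rightarrow> nat) \<Rightarrow> real" where
  "s_perm M n \<pi> = optimal_expected_length M (count_space UNIV) n (\<lambda>i \<omega>. \<pi> \<omega> i)"

definition s_indep :: "'a measure \<Rightarrow> nat \<Rightarrow> (nat \<Rightarrow> 'a \<Rightarrow> real) \<Rightarrow> real" where
  "s_indep M n X = optimal_expected_length M borel n X"

end

theory Submission
  imports Defs
begin

text \<open>Let \<open>f(x)\<close> be the length obtained by a given strategy for the independent sequence when the
  observations are \<open>x = (x\<^sub>1, \<dots>, x\<^sub>n)\<close>. Exchangeability gives
  \<open>E f(X) = E ((1/n!) \<Sum>\<^sub>p f(X \<circ> p))\<close>. For each fixed \<open>x\<close>, substituting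
  \<open>p \<mapsto> \<sigma> \<circ> p\<close> with a permutation \<open>\<sigma>\<close> that sorts \<open>x\<close> replaces \<open>x\<close> by a sorted vector \<open>u\<close>.
  Selecting from a random permutation \<open>\<pi>\<close> as if \<open>u \<circ> \<pi>\<close> had been observed is a
  feasible strategy for the permutation problem, and it selects at least \<open>f(u \<circ> \<pi>)\<close> elements because
  \<open>u (\<pi> i) < u (\<pi> j)\<close> implies \<open>\<pi> i < \<pi> j\<close>; ties in \<open>u\<close> do no harm.\<close>

section \<open>Selections as index sets\<close>

text \<open>For \<open>S\<close> within \<open>{1..n}\<close> this is the length of the increasing
  run with which the selections in \<open>S\<close> start: the counted \<open>k\<close> form an
  initial segment of \<open>S\<close>. Counting elements, rather than enumerating \<open>S\<close>,
  reduces comparison to set inclusion and measurability to a finite sum of indicators.\<close>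

definition chain_length :: "nat set \<Rightarrow> (nat \<Rightarrow> 'v::linorder) \<Rightarrow> nat" where
  "chain_length S y = card {k \<in> S. strict_mono_on (S \<inter> {..k}) y}"

lemma chain_length_le:
  assumes "S \<subseteq> {1..n}"
  shows "chain_length S y \<le> n"
proof -
  have "chain_length S y \<le> card {1..n}"
    unfolding chain_length_def using assms by (intro card_mono) auto
  then show ?thesis by simp
qed

text \<open>Strict monotonicity on each \<open>S \<inter> {..k}\<close> passes from \<open>y\<close>
  to \<open>z\<close>. Only strict inequalities of \<open>y\<close> have to be respected, which is
  why ties in \<open>y\<close> do no harm.\<close>

lemma chain_length_mono:
  assumes "S \<subseteq> {1..n}" and "\<And>i j. i \<in> S \<Longrightarrow> j \<in> S \<Longrightarrow> y i < y j \<Longrightarrow> z i < z j"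
  shows "chain_length S y \<le> chain_length S z"
  unfolding chain_length_def
proof (rule card_mono)
  show "finite {k \<in> S. strict_mono_on (S \<inter> {..k}) z}"
    using finite_subset[OF assms(1)] by simp
  show "{k \<in> S. strict_mono_on (S \<inter> {..k}) y} \<subseteq> {k \<in> S. strict_mono_on (S \<inter> {..k}) z}"
    using assms(2) by (auto simp: strict_mono_on_def)
qed

text \<open>The finite values of \<open>\<tau>\<close> at \<open>\<omega>\<close> enumerate the
  selected set in increasing order, so the length depends on that set and the observations alone.
  Strategies can then be handled as index sets.\<close>

lemma selected_length_eq_chain_length:
  fixes Y :: "nat \<Rightarrow> 'a \<Rightarrow> 'v::linorder" and \<tau> :: "nat \<Rightarrow> 'a \<Rightarrow> enat"
  assumes range: "\<And>j. j \<ge> 1 \<Longrightarrow> \<tau> j \<omega> \<in> enat ` {1..n} \<union> {\<infinity>}"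
    and less: "\<And>j. j \<ge> 1 \<Longrightarrow> \<tau> j \<omega> \<noteq> \<infinity> \<Longrightarrow> \<tau> j \<omega> < \<tau> (Suc j) \<omega>"
    and inf: "\<And>j. j \<ge> 1 \<Longrightarrow> \<tau> j \<omega> = \<infinity> \<Longrightarrow> \<tau> (Suc j) \<omega> = \<infinity>"
  shows "selected_length n Y \<tau> \<omega> = chain_length {k. \<exists>j\<ge>1. \<tau> j \<omega> = enat k} (\<lambda>k. Y k \<omega>)"
proof -
  define t where "t j = \<tau> j \<omega>" for j
  define y where "y k = Y k \<omega>" for k
  define S where "S = {k. \<exists>j\<ge>1. t j = enat k}"
  define C where "C = {k \<in> S. strict_mono_on (S \<inter> {..k}) y}"
  \<comment> \<open>\<open>J\<close> holds the ranks of the elements of \<open>C\<close>. It turns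
    out to be an initial segment of the positive integers, in bijection with
    \<open>C\<close>.\<close>
  define J where "J = {j. j \<ge> 1 \<and> t j \<in> enat ` C}"
  have S_sub: "S \<subseteq> {1..n}"
    using range by (force simp: S_def t_def)
  have tless: "t i < t j" if "1 \<le> i" "i < j" "t i \<noteq> \<infinity>" for i j
    using that(2)
  proof (induction j rule: less_induct)
    case (less j)
    then obtain m where m: "j = Suc m" "i \<le> m" by (cases j) auto
    show ?case
    proof (cases "i = m")
      case True
      then show ?thesis using assms(2)[of i] that m by (simp add: t_def)
    next
      case False
      then have "t i < t m" using less m by auto
      moreover have "t m \<le> t (Suc m)"
        using assms(2,3)[of m] that m by (cases "t m = \<infinity>") (auto simp: t_def)
      ultimately show ?thesis using m by auto
    qed
  qed
  \<comment> \<open>The condition under the maximum in \<open>selected_length\<close> says that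
    \<open>{1..k}\<close> lies in \<open>J\<close>. Consecutive inequalities chain to all pairs in
    one direction; in the other, each time in \<open>C\<close> already carries monotonicity on
    everything selected before it.\<close>
  have K_iff: "((\<forall>j\<in>{1..k}. 1 \<le> t j \<and> t j \<le> enat n) \<and> (\<forall>j\<in>{1..<k}. t j < t (Suc j)) \<and>
      (\<forall>j\<in>{1..<k}. y (the_enat (t j)) < y (the_enat (t (Suc j))))) \<longleftrightarrow> {1..k} \<subseteq> J"
    (is "?L \<longleftrightarrow> _") for k
  proof
    assume L: ?L
    have ylt: "y (the_enat (t i)) < y (the_enat (t j))" if "1 \<le> i" "i < j" "j \<le> k" for i j
      using that(2,3)
    proof (induction j)
      case (Suc j)
      have "y (the_enat (t j)) < y (the_enat (t (Suc j)))" using L Suc that(1) by auto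
      then show ?case using Suc by (cases "i = j") auto
    qed auto
    show "{1..k} \<subseteq> J"
    proof
      fix j assume j: "j \<in> {1..k}"
      then obtain c where c: "t j = enat c" using L enat_ile by blast
      have "strict_mono_on (S \<inter> {..c}) y"
      proof (rule strict_mono_onI)
        fix a b assume ab: "a \<in> S \<inter> {..c}" "b \<in> S \<inter> {..c}" "a < b"
        then obtain i i' where i: "i \<ge> 1" "t i = enat a" "i' \<ge> 1" "t i' = enat b"
          by (auto simp: S_def)
        have "i < i'" using tless[of i' i] i ab by (cases i i' rule: linorder_cases) auto
        moreover have "i' \<le> j" using tless[of j i'] i j c ab by (cases "i' \<le> j") auto
        ultimately show "y a < y b" using ylt[of i i'] i j by auto
      qed
      then show "j \<in> J" using j c by (auto simp: J_def C_def S_def)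
    qed
  next
    assume sub: "{1..k} \<subseteq> J"
    have fin: "\<exists>c\<in>C. t j = enat c" if "j \<in> {1..k}" for j
      using sub that by (auto simp: J_def)
    have 1: "1 \<le> t j \<and> t j \<le> enat n" if j: "j \<in> {1..k}" for j
    proof -
      obtain c where "c \<in> C" "t j = enat c" using fin[OF j] by blast
      then show ?thesis using S_sub by (auto simp: C_def one_enat_def)
    qed
    have 2: "t j < t (Suc j)" if j: "j \<in> {1..<k}" for j
      using fin[of j] tless[of j "Suc j"] j by auto
    have 3: "y (the_enat (t j)) < y (the_enat (t (Suc j)))" if j: "j \<in> {1..<k}" for j
    proof -
      obtain c where c: "c \<in> C" "t j = enat c" using fin[of j] j by auto
      obtain c' where c': "c' \<in> C" "t (Suc j) = enat c'" using fin[of "Suc j"] j by auto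
      have "c < c'" using 2[OF j] c c' by simp
      then show ?thesis using c c' by (auto simp: C_def strict_mono_on_def)
    qed
    show ?L using 1 2 3 by blast
  qed
  have finC: "finite C" using finite_subset[OF S_sub] by (simp add: C_def)
  \<comment> \<open>An infinite \<open>t i\<close> would force all later times to be infinite,
    against \<open>t j = enat c\<close>. So \<open>t i\<close> is an earlier element of
    \<open>S\<close>, and monotonicity up to \<open>c\<close> restricts to it.\<close>
  have J_down: "i \<in> J" if "j \<in> J" "1 \<le> i" "i \<le> j" for i j
  proof (cases "i = j")
    case False
    obtain c where c: "c \<in> C" "t j = enat c" using \<open>j \<in> J\<close> by (auto simp: J_def)
    have "t i \<noteq> \<infinity>"
    proof
      assume "t i = \<infinity>"
      have "t m = \<infinity>" if "i \<le> m" for m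
        using that
      proof (induction m rule: dec_induct)
        case base
        then show ?case by fact
      next
        case (step m)
        then show ?case using inf[of m] \<open>1 \<le> i\<close> by (simp add: t_def)
      qed
      then show False using c that by simp
    qed
    then obtain d where d: "t i = enat d" by auto
    have "d < c" using tless[of i j] c d False that by auto
    then have "d \<in> C" using c d that by (auto simp: C_def S_def strict_mono_on_def)
    then show ?thesis using d that by (auto simp: J_def)
  qed (use that in simp)
  have bij: "bij_betw (\<lambda>j. the_enat (t j)) J C"
  proof (rule bij_betw_imageI)
    show "inj_on (\<lambda>j. the_enat (t j)) J"
    proof (rule linorder_inj_onI')
      fix i j assume "i \<in> J" "j \<in> J" "i < j"
      then show "the_enat (t i) \<noteq> the_enat (t j)"
        using tless[of i j] by (auto simp: J_def)
    qed
    show "(\<lambda>j. the_enat (t j)) ` J = C"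
      by (force simp: J_def C_def S_def image_iff)
  qed
  have finJ: "finite J" and cardJ: "card J = card C"
    using bij finC bij_betw_finite bij_betw_same_card by metis+
  have J_eq: "J = {1..card C}"
  proof (cases "J = {}")
    case True
    then show ?thesis using cardJ by simp
  next
    case False
    have "J = {1..Max J}"
      using J_down[OF Max_in[OF finJ False]] Max_ge[OF finJ] by (auto simp: J_def)
    then show ?thesis using cardJ by (metis card_atLeastAtMost diff_Suc_1)
  qed
  have "selected_length n Y \<tau> \<omega> = Max {k. {1..k} \<subseteq> J}"
    unfolding selected_length_def t_def[symmetric] y_def[symmetric] K_iff ..
  also have "{k. {1..k} \<subseteq> J} = {0..card C}"
    unfolding J_eq by auto
  also have "Max {0..card C} = card C"
    by (rule Max_eqI) auto
  finally show ?thesis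
    unfolding chain_length_def C_def S_def t_def y_def .
qed

text \<open>The \<open>j\<close>-th smallest element of \<open>S\<close>, or infinity if there is
  none. Describing it by its rank \<open>card (S \<inter> {..k})\<close> makes visible that whether
  \<open>k\<close> is chosen depends only on \<open>S\<close> up to \<open>k\<close>.\<close>

definition selection_time :: "nat set \<Rightarrow> nat \<Rightarrow> enat" where
  "selection_time S j =
     (if \<exists>k\<in>S. card (S \<inter> {..k}) = j then enat (LEAST k. k \<in> S \<and> card (S \<inter> {..k}) = j) else \<infinity>)"

lemma card_initial_less:
  fixes k k' :: nat
  assumes "k' \<in> S" "k < k'"
  shows "card (S \<inter> {..k}) < card (S \<inter> {..k'})"
proof (rule psubset_card_mono)
  have "k' \<in> S \<inter> {..k'}" "k' \<notin> S \<inter> {..k}" "S \<inter> {..k} \<subseteq> S \<inter> {..k'}"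
    using assms by auto
  then show "S \<inter> {..k} \<subset> S \<inter> {..k'}" by blast
qed simp

text \<open>The rank strictly increases along \<open>S\<close>, so at most one element has rank
  \<open>j\<close> and the \<open>LEAST\<close> in the definition merely names it.\<close>

lemma selection_time_eq_iff:
  "selection_time S j = enat k \<longleftrightarrow> k \<in> S \<and> card (S \<inter> {..k}) = j"
proof -
  have uniq: "k = k'" if "k \<in> S" "card (S \<inter> {..k}) = j" "k' \<in> S" "card (S \<inter> {..k'}) = j" for k k'
    using card_initial_less[of k' S k] card_initial_less[of k S k'] that
    by (cases k k' rule: linorder_cases) auto
  show ?thesis
  proof (cases "\<exists>k\<in>S. card (S \<inter> {..k}) = j")
    case True
    then obtain k0 where k0: "k0 \<in> S" "card (S \<inter> {..k0}) = j" by auto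
    then have "(LEAST k. k \<in> S \<and> card (S \<inter> {..k}) = j) = k0"
      using uniq by (intro Least_equality) auto
    then show ?thesis using True k0 uniq by (auto simp: selection_time_def)
  next
    case False
    then show ?thesis by (auto simp: selection_time_def)
  qed
qed

text \<open>The right-hand side inspects \<open>S\<close> only up to time \<open>t\<close>; this is
  what yields the stopping time property later.\<close>

lemma selection_time_le_iff:
  "selection_time S j \<le> t \<longleftrightarrow> t = \<infinity> \<or> (\<exists>k\<in>S. enat k \<le> t \<and> card (S \<inter> {..k}) = j)"
proof (cases "selection_time S j")
  case (enat k)
  have "enat k' = selection_time S j \<longleftrightarrow> k' \<in> S \<and> card (S \<inter> {..k'}) = j" for k'
    using selection_time_eq_iff[of S j k'] by auto
  then have "k' \<in> S \<and> card (S \<inter> {..k'}) = j \<longleftrightarrow> k' = k" for k'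
    using enat by auto
  then have "(\<exists>k'\<in>S. enat k' \<le> t \<and> card (S \<inter> {..k'}) = j) \<longleftrightarrow> enat k \<le> t"
    by metis
  then show ?thesis
    using enat by auto
next
  case infinity
  then show ?thesis
    using selection_time_eq_iff[of S j] by auto
qed

lemma selection_time_range:
  "S \<subseteq> {1..n} \<Longrightarrow> selection_time S j \<in> enat ` {1..n} \<union> {\<infinity>}"
  using selection_time_eq_iff[of S j] by (cases "selection_time S j") auto

lemma selection_time_less:
  assumes "selection_time S j \<noteq> \<infinity>"
  shows "selection_time S j < selection_time S (Suc j)"
proof (cases "selection_time S (Suc j)")
  case (enat k')
  obtain k where k: "selection_time S j = enat k" using assms by auto
  have "k < k'"
  proof (rule ccontr)
    assume "\<not> k < k'"
    then have "card (S \<inter> {..k'}) \<le> card (S \<inter> {..k})"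
      by (intro card_mono) auto
    then show False using k enat by (simp add: selection_time_eq_iff)
  qed
  then show ?thesis using k enat by simp
qed (use assms in auto)

text \<open>The largest element of \<open>S\<close> before one of rank \<open>Suc j\<close> has rank
  \<open>j\<close>. It exists because \<open>j \<ge> 1\<close>; rank 0 is never attained.\<close>

lemma selection_time_infinity_Suc:
  assumes "j \<ge> 1" "selection_time S j = \<infinity>"
  shows "selection_time S (Suc j) = \<infinity>"
proof (rule ccontr)
  assume "selection_time S (Suc j) \<noteq> \<infinity>"
  then obtain k' where "selection_time S (Suc j) = enat k'" by auto
  then have k': "k' \<in> S" "card (S \<inter> {..k'}) = Suc j" by (auto simp: selection_time_eq_iff)
  define A where "A = S \<inter> {..<k'}"
  have "S \<inter> {..k'} = insert k' A" using k' by (auto simp: A_def)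
  then have cA: "card A = j" using k' by (simp add: A_def)
  have fA: "finite A" "A \<noteq> {}" using cA assms(1) by (auto simp: A_def)
  have M: "Max A \<in> A" using fA by (rule Max_in)
  have "S \<inter> {..Max A} = A" using M Max_ge[OF fA(1)] by (auto simp: A_def)
  then have "selection_time S j = enat (Max A)" using M cA
    by (simp add: selection_time_eq_iff) (simp add: A_def)
  then show False using assms(2) by simp
qed

lemma selection_times_eq:
  assumes "S \<subseteq> {1..n}"
  shows "{k. \<exists>j\<ge>1. selection_time S j = enat k} = S"
proof -
  have "card (S \<inter> {..k}) \<ge> 1" if "k \<in> S" for k
    using that card_gt_0_iff[of "S \<inter> {..k}"] by auto
  then show ?thesis by (auto simp: selection_time_eq_iff)
qed

section \<open>Natural filtrations\<close>

lemma sets_natural_filtration: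
  "sets (natural_filtration M S n Y t) =
     sigma_sets (space M) {Y i -` A \<inter> space M | i A. i \<in> {1..n} \<and> enat i \<le> t \<and> A \<in> sets S}"
  unfolding natural_filtration_def by (rule sets_measure_of) auto

lemma space_natural_filtration: "space (natural_filtration M S n Y t) = space M"
  unfolding natural_filtration_def by (rule space_measure_of) auto

lemma natural_filtration_mono:
  assumes "s \<le> t"
  shows "sets (natural_filtration M S n Y s) \<subseteq> sets (natural_filtration M S n Y t)"
  unfolding sets_natural_filtration
  using assms by (intro sigma_sets_mono') (auto intro: order_trans)

text \<open>Time is discrete, so \<open>\<tau> j = enat k\<close> is the difference of the events
  for \<open>k\<close> and its predecessor, with \<open>k = 0\<close> treated apart. The union over
  \<open>j\<close> is countable.\<close>

lemma selection_event_in_natural_filtration: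
  assumes "selection_strategy M S n Y \<tau>"
  shows "{\<omega> \<in> space M. \<exists>j\<ge>1. \<tau> j \<omega> = enat k} \<in> sets (natural_filtration M S n Y (enat k))"
proof -
  let ?F = "natural_filtration M S n Y"
  have st: "{\<omega> \<in> space M. \<tau> j \<omega> \<le> t} \<in> sets (?F t)" if "j \<ge> 1" for j t
    using assms that
    by (auto simp: selection_strategy_def stopping_time_def pred_def space_natural_filtration)
  have eq: "{\<omega> \<in> space M. \<tau> j \<omega> = enat k} \<in> sets (?F (enat k))" if "j \<ge> 1" for j
  proof (cases k)
    case 0
    have "{\<omega> \<in> space M. \<tau> j \<omega> = enat k} = {\<omega> \<in> space M. \<tau> j \<omega> \<le> enat k}"
      using 0 by (auto simp: zero_enat_def[symmetric])
    then show ?thesis using st[OF that, of "enat k"] by simp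
  next
    case (Suc m)
    have "x = enat k \<longleftrightarrow> x \<le> enat k \<and> \<not> x \<le> enat m" for x
      using Suc by (cases x) auto
    then have "{\<omega> \<in> space M. \<tau> j \<omega> = enat k} =
        {\<omega> \<in> space M. \<tau> j \<omega> \<le> enat k} - {\<omega> \<in> space M. \<tau> j \<omega> \<le> enat m}"
      by auto
    then show ?thesis
      using st[OF that] natural_filtration_mono[of "enat m" "enat k" M S n Y] Suc by auto
  qed
  have "{\<omega> \<in> space M. \<exists>j\<ge>1. \<tau> j \<omega> = enat k} =
      (\<Union>j\<in>{1..}. {\<omega> \<in> space M. \<tau> j \<omega> = enat k})"
    by auto
  also have "\<dots> \<in> sets (?F (enat k))"
    using eq by (intro sets.countable_UN') auto
  finally show ?thesis .
qed

text \<open>A Doob-Dynkin factorization for events: the generators up to time \<open>k\<close> are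
  preimages of cylinders under the vector of the first \<open>k\<close> observations, so every event
  of the filtration at \<open>k\<close> is a preimage under that vector.\<close>

lemma natural_filtration_factor:
  assumes "A \<in> sets (natural_filtration N S n X (enat k))" "k \<le> n"
    and X: "\<And>i \<omega>. i \<in> {1..n} \<Longrightarrow> \<omega> \<in> space N \<Longrightarrow> X i \<omega> \<in> space S"
  shows "\<exists>B\<in>sets (\<Pi>\<^sub>M i\<in>{1..k}. S). A = {\<omega> \<in> space N. (\<lambda>i\<in>{1..k}. X i \<omega>) \<in> B}"
proof -
  let ?P = "\<Pi>\<^sub>M i\<in>{1..k}. S" and ?f = "\<lambda>\<omega>. \<lambda>i\<in>{1..k}. X i \<omega>"
  let ?V = "vimage_algebra (space N) ?f ?P"
  have f: "?f \<in> space N \<rightarrow> space ?P"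
    using X assms(2) by (auto simp: space_PiM)
  have "{X i -` A \<inter> space N | i A. i \<in> {1..n} \<and> enat i \<le> enat k \<and> A \<in> sets S} \<subseteq> sets ?V"
  proof clarify
    fix i A assume i: "i \<in> {1..n}" "enat i \<le> enat k" "A \<in> sets S"
    then have "(\<lambda>x. x i) -` A \<inter> space ?P \<in> sets ?P"
      by (intro measurable_sets[OF measurable_component_singleton]) auto
    then have "?f -` ((\<lambda>x. x i) -` A \<inter> space ?P) \<inter> space N \<in> sets ?V"
      by (rule in_vimage_algebra)
    also have "?f -` ((\<lambda>x. x i) -` A \<inter> space ?P) \<inter> space N = X i -` A \<inter> space N"
      using i f by auto
    finally show "X i -` A \<inter> space N \<in> sets ?V" .
  qed
  then have "sets (natural_filtration N S n X (enat k)) \<subseteq> sets ?V"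
    unfolding sets_natural_filtration
    using sets.sigma_sets_subset[of _ ?V] by simp
  then have "A \<in> {?f -` B \<inter> space N | B. B \<in> sets ?P}"
    using assms(1) sets_vimage_algebra2[OF f] by blast
  then show ?thesis by auto
qed

section \<open>Strategies for the permutation problem\<close>

text \<open>There are finitely many permutations, so a property decided by the values up to time
  \<open>t\<close> is a finite union of events that prescribe exactly these values.\<close>

lemma permutation_event_in_natural_filtration:
  assumes perm: "\<And>\<omega>. \<omega> \<in> space M \<Longrightarrow> \<pi> \<omega> permutes {1..n}"
    and Q: "\<And>p q. p permutes {1..n} \<Longrightarrow> q permutes {1..n} \<Longrightarrow>
      (\<And>i. i \<in> {1..n} \<Longrightarrow> enat i \<le> t \<Longrightarrow> p i = q i) \<Longrightarrow> Q p \<Longrightarrow> Q q"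
  shows "{\<omega> \<in> space M. Q (\<pi> \<omega>)}
    \<in> sets (natural_filtration M (count_space UNIV) n (\<lambda>i \<omega>. \<pi> \<omega> i) t)"
proof -
  let ?F = "natural_filtration M (count_space UNIV) n (\<lambda>i \<omega>. \<pi> \<omega> i) t"
  let ?I = "{i \<in> {1..n}. enat i \<le> t}"
  have one: "{\<omega> \<in> space M. \<pi> \<omega> i = p i} \<in> sets ?F" if "i \<in> ?I" for i p
    unfolding sets_natural_filtration using that
    by (intro sigma_sets.Basic CollectI exI[of _ i] exI[of _ "{p i}"]) auto
  have all: "{\<omega> \<in> space M. \<forall>i\<in>?I. \<pi> \<omega> i = p i} \<in> sets ?F" for p
  proof -
    have "{\<omega> \<in> space ?F. \<forall>i\<in>?I. \<pi> \<omega> i = p i} \<in> sets ?F"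
    proof (rule sets.sets_Collect_countable_All')
      show "countable ?I" by (rule countableI_type)
    qed (unfold space_natural_filtration, rule one)
    then show ?thesis unfolding space_natural_filtration .
  qed
  have "(\<Union>p\<in>{p. p permutes {1..n} \<and> Q p}. {\<omega> \<in> space M. \<forall>i\<in>?I. \<pi> \<omega> i = p i}) \<in> sets ?F"
    by (intro sets.finite_UN finite_subset[OF _ finite_permutations[of "{1..n}"]] all) blast+
  also have "(\<Union>p\<in>{p. p permutes {1..n} \<and> Q p}. {\<omega> \<in> space M. \<forall>i\<in>?I. \<pi> \<omega> i = p i}) =
      {\<omega> \<in> space M. Q (\<pi> \<omega>)}"
  proof (intro set_eqI iffI)
    fix \<omega> assume "\<omega> \<in> (\<Union>p\<in>{p. p permutes {1..n} \<and> Q p}. {\<omega> \<in> space M. \<forall>i\<in>?I. \<pi> \<omega> i = p i})"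
    then obtain p where "p permutes {1..n}" "Q p" "\<omega> \<in> space M" "\<forall>i\<in>?I. \<pi> \<omega> i = p i" by blast
    then show "\<omega> \<in> {\<omega> \<in> space M. Q (\<pi> \<omega>)}" using Q[of p "\<pi> \<omega>"] perm by auto
  next
    fix \<omega> assume "\<omega> \<in> {\<omega> \<in> space M. Q (\<pi> \<omega>)}"
    then show "\<omega> \<in> (\<Union>p\<in>{p. p permutes {1..n} \<and> Q p}. {\<omega> \<in> space M. \<forall>i\<in>?I. \<pi> \<omega> i = p i})"
      using perm by auto
  qed
  finally show ?thesis .
qed

lemma selected_length_le:
  assumes "selection_strategy M S n Y \<tau>" "\<omega> \<in> space M"
  shows "selected_length n Y \<tau> \<omega> \<le> n"
proof -
  have "selected_length n Y \<tau> \<omega> = chain_length {k. \<exists>j\<ge>1. \<tau> j \<omega> = enat k} (\<lambda>k. Y k \<omega>)"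
    using assms by (intro selected_length_eq_chain_length) (auto simp: selection_strategy_def)
  also have "\<dots> \<le> n"
    using assms by (intro chain_length_le) (force simp: selection_strategy_def)
  finally show ?thesis .
qed

text \<open>The supremum of reals bounds its members only if they are bounded above; the bound
  \<open>n\<close> on the length provides this.\<close>

lemma expectation_le_optimal:
  assumes "prob_space M" "selection_strategy M S n Y \<tau>"
  shows "prob_space.expectation M (\<lambda>\<omega>. real (selected_length n Y \<tau> \<omega>))
    \<le> optimal_expected_length M S n Y"
  unfolding optimal_expected_length_def
proof (rule cSUP_upper)
  interpret prob_space M by fact
  show "bdd_above ((\<lambda>\<tau>. expectation (\<lambda>\<omega>. real (selected_length n Y \<tau> \<omega>))) `
      {\<tau>. selection_strategy M S n Y \<tau>})"
  proof (rule bdd_aboveI2)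
    fix \<tau> assume "\<tau> \<in> {\<tau>. selection_strategy M S n Y \<tau>}"
    \<comment> \<open>\<open>integral_mono'\<close> asks for integrability of the dominating
      constant only.\<close>
    then have "expectation (\<lambda>\<omega>. real (selected_length n Y \<tau> \<omega>)) \<le> expectation (\<lambda>_. real n)"
      using selected_length_le by (intro integral_mono') auto
    then show "expectation (\<lambda>\<omega>. real (selected_length n Y \<tau> \<omega>)) \<le> real n"
      by (simp add: prob_space)
  qed
qed (use assms in simp)

text \<open>A non-anticipating rule \<open>T\<close> becomes a feasible strategy by enumerating
  \<open>T (\<pi> \<omega>)\<close> with \<open>selection_time\<close>. Its expected length is the
  average over all permutations, and the factor \<open>fact n\<close> clears the
  denominator.\<close>

lemma sum_chain_length_le_s_perm:
  assumes \<pi>: "uniform_random_permutation M n \<pi>"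
    and sub: "\<And>p. T p \<subseteq> {1..n}"
    and adapted: "\<And>p q k. p permutes {1..n} \<Longrightarrow> q permutes {1..n} \<Longrightarrow> k \<le> n \<Longrightarrow>
      (\<And>i. i \<in> {1..k} \<Longrightarrow> p i = q i) \<Longrightarrow> k \<in> T p \<Longrightarrow> k \<in> T q"
  shows "(\<Sum>p | p permutes {1..n}. real (chain_length (T p) p)) \<le> fact n * s_perm M n \<pi>"
proof -
  let ?Perm = "{p. p permutes {1..n}}"
  interpret prob_space M using \<pi> by (simp add: uniform_random_permutation_def)
  have meas: "\<pi> \<in> M \<rightarrow>\<^sub>M count_space ?Perm"
    and distr: "distr M (count_space ?Perm) \<pi> = uniform_count_measure ?Perm"
    using \<pi> by (auto simp: uniform_random_permutation_def)
  have perm: "\<pi> \<omega> permutes {1..n}" if "\<omega> \<in> space M" for \<omega>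
    using measurable_space[OF meas that] by simp
  define \<tau> where "\<tau> j \<omega> = selection_time (T (\<pi> \<omega>)) j" for j \<omega>
  have strat: "selection_strategy M (count_space UNIV) n (\<lambda>i \<omega>. \<pi> \<omega> i) \<tau>"
    unfolding selection_strategy_def
  proof (intro conjI allI impI ballI)
    fix j :: nat assume "j \<ge> 1"
    show "stopping_time (natural_filtration M (count_space UNIV) n (\<lambda>i \<omega>. \<pi> \<omega> i)) (\<tau> j)"
      unfolding stopping_time_def pred_def space_natural_filtration \<tau>_def
    proof (intro allI permutation_event_in_natural_filtration perm)
      fix t p q
      assume pq: "p permutes {1..n}" "q permutes {1..n}" "selection_time (T p) j \<le> t"
        and eq: "\<And>i. i \<in> {1..n} \<Longrightarrow> enat i \<le> t \<Longrightarrow> p i = q i"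
      show "selection_time (T q) j \<le> t"
      proof (cases "t = \<infinity>")
        case False
        then obtain k where k: "k \<in> T p" "enat k \<le> t" "card (T p \<inter> {..k}) = j"
          using pq(3) by (auto simp: selection_time_le_iff)
        \<comment> \<open>Membership of each \<open>i \<le> k\<close> is decided by values that
          \<open>p\<close> and \<open>q\<close> share, so \<open>adapted\<close> in both directions
          gives the same set up to \<open>k\<close>, hence the same rank of
          \<open>k\<close>.\<close>
        have "i \<in> T p \<longleftrightarrow> i \<in> T q" if i: "i \<le> k" for i
        proof -
          have "k \<le> n" using k sub[of p] by auto
          moreover have "p a = q a" if "a \<in> {1..i}" for a
            using eq[of a] that i k \<open>k \<le> n\<close> order_trans[of "enat a" "enat k" t] by auto
          ultimately show ?thesis using adapted[of p q i] adapted[of q p i] pq i by auto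
        qed
        then have "T p \<inter> {..k} = T q \<inter> {..k}" "k \<in> T q" using k by auto
        then show ?thesis using k by (auto simp: selection_time_le_iff)
      qed simp
    qed
  qed (use sub selection_time_range[OF sub] selection_time_less selection_time_infinity_Suc
      in \<open>auto simp: \<tau>_def\<close>)
  have len: "selected_length n (\<lambda>i \<omega>. \<pi> \<omega> i) \<tau> \<omega> = chain_length (T (\<pi> \<omega>)) (\<pi> \<omega>)" for \<omega>
  proof -
    have "selected_length n (\<lambda>i \<omega>. \<pi> \<omega> i) \<tau> \<omega> =
        chain_length {k. \<exists>j\<ge>1. \<tau> j \<omega> = enat k} (\<lambda>k. \<pi> \<omega> k)"
      unfolding \<tau>_def using selection_time_range[OF sub] selection_time_less
        selection_time_infinity_Suc
      by (intro selected_length_eq_chain_length) auto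
    then show ?thesis using selection_times_eq[OF sub] by (simp add: \<tau>_def)
  qed
  have "expectation (\<lambda>\<omega>. real (selected_length n (\<lambda>i \<omega>. \<pi> \<omega> i) \<tau> \<omega>)) =
      (\<integral>p. real (chain_length (T p) p) \<partial>distr M (count_space ?Perm) \<pi>)"
    unfolding len using meas by (subst integral_distr) auto
  also have "\<dots> = (\<Sum>p\<in>?Perm. real (chain_length (T p) p)) / fact n"
    unfolding distr using finite_permutations[of "{1..n}"] card_permutations[of "{1..n}" n]
    by (simp add: integral_uniform_count_measure)
  finally have "(\<Sum>p\<in>?Perm. real (chain_length (T p) p)) / fact n \<le> s_perm M n \<pi>"
    using expectation_le_optimal[OF prob_space_axioms strat] by (simp add: s_perm_def)
  then show ?thesis by (simp add: field_simps)
qed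

section \<open>Symmetrization\<close>

lemma sorting_permutation_exists:
  fixes x :: "nat \<Rightarrow> 'v::linorder"
  obtains \<sigma> where "\<sigma> permutes {1..n}" "mono_on {1..n} (x \<circ> \<sigma>)"
proof -
  define l where "l = sort_key x [1..<Suc n]"
  \<comment> \<open>List positions start at 0, hence the shift; outside \<open>{1..n}\<close> the
    identity is required by \<open>permutes\<close>.\<close>
  define \<sigma> where "\<sigma> i = (if i \<in> {1..n} then l ! (i - 1) else i)" for i
  have len: "length l = n" and dist: "distinct l" and set: "set l = {1..n}"
    by (auto simp: l_def)
  have sorted: "sorted (map x l)" by (simp add: l_def)
  have inj: "inj_on \<sigma> {1..n}"
    using dist len by (auto simp: inj_on_def \<sigma>_def nth_eq_iff_index_eq)
  have "\<sigma> ` {1..n} \<subseteq> {1..n}"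
    using nth_mem[of _ l] len set by (force simp: \<sigma>_def)
  then have "\<sigma> ` {1..n} = {1..n}" using inj by (intro endo_inj_surj) auto
  then have "\<sigma> permutes {1..n}"
    using inj by (intro bij_imp_permutes) (auto simp: bij_betw_def \<sigma>_def)
  moreover have "mono_on {1..n} (x \<circ> \<sigma>)"
    using sorted len by (auto simp: mono_on_def \<sigma>_def sorted_iff_nth_mono)
  ultimately show ?thesis using that by blast
qed

lemma sum_permuted_chain_length_le_s_perm:
  fixes x :: "nat \<Rightarrow> 'v::linorder"
  assumes \<pi>: "uniform_random_permutation M n \<pi>"
    and sub: "\<And>x. T x \<subseteq> {1..n}"
    and adapted: "\<And>x y k. k \<le> n \<Longrightarrow> (\<And>i. i \<in> {1..k} \<Longrightarrow> x i = y i) \<Longrightarrow> k \<in> T x \<Longrightarrow> k \<in> T y"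
  shows "(\<Sum>p | p permutes {1..n}. real (chain_length (T (x \<circ> p)) (x \<circ> p)))
    \<le> fact n * s_perm M n \<pi>"
proof -
  obtain \<sigma> where \<sigma>: "\<sigma> permutes {1..n}" "mono_on {1..n} (x \<circ> \<sigma>)"
    by (rule sorting_permutation_exists)
  define u where "u = x \<circ> \<sigma>"
  have "(\<Sum>p | p permutes {1..n}. real (chain_length (T (x \<circ> p)) (x \<circ> p))) =
      (\<Sum>p | p permutes {1..n}. real (chain_length (T (u \<circ> p)) (u \<circ> p)))"
    unfolding u_def comp_assoc using \<sigma>(1) by (rule setum_permutations_compose_left)
  \<comment> \<open>The selected set stays \<open>T (u \<circ> p)\<close>; only the values being
    compared change from \<open>u \<circ> p\<close> to \<open>p\<close>. As \<open>u\<close> is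
    nondecreasing on \<open>{1..n}\<close>, a strict inequality between its values forces the same
    one between the arguments.\<close>
  also have "\<dots> \<le> (\<Sum>p | p permutes {1..n}. real (chain_length (T (u \<circ> p)) p))"
  proof (intro sum_mono of_nat_mono chain_length_mono[OF sub])
    fix p i j
    assume "p \<in> {p. p permutes {1..n}}" and "i \<in> T (u \<circ> p)" "j \<in> T (u \<circ> p)"
      and less: "(u \<circ> p) i < (u \<circ> p) j"
    then have "p i \<in> {1..n}" "p j \<in> {1..n}"
      using sub[of "u \<circ> p"] permutes_in_image[of p "{1..n}"] by auto
    then show "p i < p j"
      using less mono_onD[OF \<sigma>(2), of "p j" "p i"] by (force simp: u_def not_less)
  qed
  also have "\<dots> \<le> fact n * s_perm M n \<pi>"
    \<comment> \<open>With \<open>u\<close> fixed, \<open>T (u \<circ> p)\<close> is a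
      non-anticipating rule in \<open>p\<close>: permutations that agree up to \<open>k\<close> give
      vectors that agree up to \<open>k\<close>.\<close>
    using \<pi> sub by (rule sum_chain_length_le_s_perm) (rule adapted, auto)
  finally show ?thesis .
qed

text \<open>Permuting the coordinates preserves a product of equal factors, so the integral of
  \<open>f\<close> equals that of its average over all permutations, which is bounded pointwise. The
  restriction to \<open>{1..n}\<close> keeps permuted vectors in the product space.\<close>

lemma expectation_le_of_sum_permutations_le:
  fixes f :: "(nat \<Rightarrow> 'v) \<Rightarrow> real"
  assumes D: "prob_space D"
    and f: "integrable (\<Pi>\<^sub>M i\<in>{1..n}. D) f"
    and le: "\<And>x. (\<Sum>p | p permutes {1..n}. f (\<lambda>i\<in>{1..n}. x (p i))) \<le> fact n * c"
  shows "integral\<^sup>L (\<Pi>\<^sub>M i\<in>{1..n}. D) f \<le> c"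
proof -
  let ?P = "\<Pi>\<^sub>M i\<in>{1..n}. D" and ?Perm = "{p. p permutes {1..n}}"
  let ?r = "\<lambda>p x. \<lambda>i\<in>{1..n}. x (p i)"
  interpret P: prob_space ?P using D by (intro prob_space_PiM)
  have r: "?r p \<in> ?P \<rightarrow>\<^sub>M ?P" if "p \<in> ?Perm" for p
    using that permutes_in_image[of p "{1..n}"]
    by (intro measurable_restrict measurable_component_singleton) auto
  have inv: "distr ?P ?P (?r p) = ?P" if "p \<in> ?Perm" for p
    using that D permutes_in_image[of p "{1..n}"]
    by (intro distr_PiM_reindex) (auto intro: permutes_inj_on)
  have int: "integrable ?P (\<lambda>x. f (?r p x))" if "p \<in> ?Perm" for p
    using integrable_distr[of "?r p" ?P ?P f] r inv f that by auto
  have "fact n * integral\<^sup>L ?P f = (\<Sum>p\<in>?Perm. integral\<^sup>L ?P f)"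
    using card_permutations[of "{1..n}" n] by simp
  also have "\<dots> = (\<Sum>p\<in>?Perm. integral\<^sup>L ?P (\<lambda>x. f (?r p x)))"
  proof (rule sum.cong)
    fix p assume p: "p \<in> ?Perm"
    show "integral\<^sup>L ?P f = integral\<^sup>L ?P (\<lambda>x. f (?r p x))"
      using integral_distr[OF r[OF p], of f] inv[OF p] f by auto
  qed simp
  also have "\<dots> = integral\<^sup>L ?P (\<lambda>x. \<Sum>p\<in>?Perm. f (?r p x))"
    using int by (intro Bochner_Integration.integral_sum[symmetric]) auto
  also have "\<dots> \<le> integral\<^sup>L ?P (\<lambda>_. fact n * c)"
    using int le by (intro integral_mono Bochner_Integration.integrable_sum P.integrable_const)
      auto
  also have "\<dots> = fact n * c" using P.prob_space by (simp only: lebesgue_integral_const scaleR_one)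
  finally show ?thesis by simp
qed

lemma borel_measurable_chain_length:
  fixes T :: "(nat \<Rightarrow> real) \<Rightarrow> nat set"
  assumes sub: "\<And>x. T x \<subseteq> {1..n}"
    and T[measurable]: "\<And>k. k \<in> {1..n} \<Longrightarrow> Measurable.pred (\<Pi>\<^sub>M i\<in>{1..n}. borel) (\<lambda>x. k \<in> T x)"
  shows "(\<lambda>x. real (chain_length (T x) x)) \<in> borel_measurable (\<Pi>\<^sub>M i\<in>{1..n}. borel)"
proof -
  \<comment> \<open>Quantifying over the fixed set \<open>{1..n}\<close> instead of the varying
    \<open>T x\<close> leaves finitely many measurable conditions.\<close>
  let ?Q = "\<lambda>k x. k \<in> T x \<and> (\<forall>a\<in>{1..n}. \<forall>b\<in>{1..n}.
    a \<in> T x \<longrightarrow> b \<in> T x \<longrightarrow> b \<le> k \<longrightarrow> a < b \<longrightarrow> x a < x b)"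
  have eq: "{k \<in> T x. strict_mono_on (T x \<inter> {..k}) x} = {k \<in> {1..n}. ?Q k x}" for x
    using subsetD[OF sub[of x]]
    by (intro Collect_cong) (auto simp: strict_mono_on_def simp del: atLeastAtMost_iff)
  have "real (chain_length (T x) x) = (\<Sum>k\<in>{1..n}. of_bool (?Q k x))" for x
    unfolding chain_length_def eq by (simp add: Int_def)
  moreover have "(\<lambda>x. \<Sum>k\<in>{1..n}. of_bool (?Q k x) :: real)
      \<in> borel_measurable (\<Pi>\<^sub>M i\<in>{1..n}. borel)"
    unfolding of_bool_def by measurable
  ultimately show ?thesis by simp
qed

section \<open>Transfer of a strategy for the independent sequence\<close>

theorem theorem2:
  fixes n :: nat
    and M :: "'a measure" and \<pi> :: "'a \<Rightarrow> nat \<Rightarrow> nat"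
    and N :: "'b measure" and X :: "nat \<Rightarrow> 'b \<Rightarrow> real"
  assumes "n \<ge> 1"
    and "uniform_random_permutation M n \<pi>"
    and "iid_uniform01 N n X"
  shows "s_indep N n X \<le> s_perm M n \<pi>"
  unfolding s_indep_def optimal_expected_length_def
proof (rule cSUP_least)
  \<comment> \<open>Never selecting is feasible, so the supremum is over a nonempty set.\<close>
  have "selection_strategy N borel n X (\<lambda>_ _. \<infinity>)"
    by (auto simp: selection_strategy_def stopping_time_def)
  then show "{\<tau>. selection_strategy N borel n X \<tau>} \<noteq> {}" by blast
next
  fix \<tau> assume "\<tau> \<in> {\<tau>. selection_strategy N borel n X \<tau>}"
  then have strat: "selection_strategy N borel n X \<tau>" by simp
  interpret N: prob_space N using assms(3) by (simp add: iid_uniform01_def)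
  define U :: "real measure" where "U = uniform_measure lborel {0..1}"
  let ?P = "\<Pi>\<^sub>M i\<in>{1..n}. U" and ?B = "\<Pi>\<^sub>M i\<in>{1..n}. (borel :: real measure)"
  let ?X = "\<lambda>\<omega>. \<lambda>i\<in>{1..n}. X i \<omega>"
  have indep: "N.indep_vars (\<lambda>_. borel) X {1..n}"
    and U: "\<And>i. i \<in> {1..n} \<Longrightarrow> distr N borel (X i) = U"
    using assms(3) by (auto simp: iid_uniform01_def U_def)
  have rv[measurable]: "X i \<in> borel_measurable N" if "i \<in> {1..n}" for i
    using indep that by (auto simp: N.indep_vars_def)
  \<comment> \<open>\<open>U\<close> is the law of \<open>X 1\<close>, which is available because
    \<open>n \<ge> 1\<close>.\<close>
  have U_prob: "prob_space U"
    using N.prob_space_distr[OF rv[of 1]] U[of 1] assms(1) by simp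
  have "distr N ?B ?X = (\<Pi>\<^sub>M i\<in>{1..n}. distr N borel (X i))"
    using indep N.indep_vars_iff_distr_eq_PiM'[of "{1..n}" X "\<lambda>_. borel"] rv assms(1) by auto
  also have "\<dots> = ?P" by (rule PiM_cong) (auto simp: U)
  finally have distr: "distr N ?B ?X = ?P" .
  have sets_P: "sets ?P = sets ?B" by (subst distr[symmetric]) simp

  have "\<forall>k\<in>{1..n}. \<exists>B. B \<in> sets (\<Pi>\<^sub>M i\<in>{1..k}. (borel :: real measure)) \<and>
      {\<omega> \<in> space N. \<exists>j\<ge>1. \<tau> j \<omega> = enat k} = {\<omega> \<in> space N. (\<lambda>i\<in>{1..k}. X i \<omega>) \<in> B}"
    using natural_filtration_factor[OF selection_event_in_natural_filtration[OF strat]]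
    by (auto simp: Bex_def)
  from bchoice[OF this] obtain B where B:
      "\<And>k. k \<in> {1..n} \<Longrightarrow> B k \<in> sets (\<Pi>\<^sub>M i\<in>{1..k}. (borel :: real measure))"
      "\<And>k. k \<in> {1..n} \<Longrightarrow> {\<omega> \<in> space N. \<exists>j\<ge>1. \<tau> j \<omega> = enat k} =
        {\<omega> \<in> space N. (\<lambda>i\<in>{1..k}. X i \<omega>) \<in> B k}"
    by blast
  \<comment> \<open>The strategy was given only on outcomes of \<open>N\<close>; the sets
    \<open>B k\<close> extend it to all real vectors, including rearranged ones. Since
    \<open>B k\<close> sees only the first \<open>k\<close> coordinates, the rule is
    non-anticipating.\<close>
  define T where "T x = {k \<in> {1..n}. restrict x {1..k} \<in> B k}" for x
  have T_sub: "T x \<subseteq> {1..n}" for x by (auto simp: T_def)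
  have T_adapted: "k \<in> T y" if "\<And>i. i \<in> {1..k} \<Longrightarrow> x i = y i" "k \<in> T x" for x y k
    using that restrict_ext[of "{1..k}" x y] by (simp add: T_def)
  \<comment> \<open>Elements of the product space are undefined outside \<open>{1..n}\<close>, while
    \<open>x \<circ> p\<close> is a total function; this passes between the two.\<close>
  have T_restrict: "chain_length (T (restrict x {1..n})) (restrict x {1..n}) =
      chain_length (T x) x" for x
  proof -
    have "T (restrict x {1..n}) = T x"
      unfolding T_def by (intro Collect_cong conj_cong refl) (simp add: Int_absorb1)
    then show ?thesis
      using subsetD[OF T_sub[of x]]
      by (simp only:) (intro antisym chain_length_mono[OF T_sub], simp_all)
  qed
  define f where "f x = real (chain_length (T x) x)" for x
  have f_meas: "f \<in> borel_measurable ?B"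
    unfolding f_def
  proof (rule borel_measurable_chain_length[OF T_sub])
    fix k assume k: "k \<in> {1..n}"
    have "(\<lambda>x. restrict x {1..k}) \<in> ?B \<rightarrow>\<^sub>M (\<Pi>\<^sub>M i\<in>{1..k}. borel)"
      using k by (intro measurable_restrict_subset) auto
    then have "Measurable.pred ?B (\<lambda>x. restrict x {1..k} \<in> B k)"
      using B(1)[OF k] by measurable
    then show "Measurable.pred ?B (\<lambda>x. k \<in> T x)"
      using k by (simp add: T_def)
  qed
  have len: "real (selected_length n X \<tau> \<omega>) = f (?X \<omega>)" if \<omega>: "\<omega> \<in> space N" for \<omega>
  proof -
    have range: "\<tau> j \<omega> \<in> enat ` {1..n} \<union> {\<infinity>}" if "j \<ge> 1" for j
      using strat \<omega> that by (auto simp: selection_strategy_def)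
    have "{k. \<exists>j\<ge>1. \<tau> j \<omega> = enat k} = T (\<lambda>i. X i \<omega>)"
    proof (intro set_eqI)
      fix k
      have "k \<in> {1..n}" if "\<exists>j\<ge>1. \<tau> j \<omega> = enat k"
        using range that by force
      then show "k \<in> {k. \<exists>j\<ge>1. \<tau> j \<omega> = enat k} \<longleftrightarrow> k \<in> T (\<lambda>i. X i \<omega>)"
        using B(2)[of k] \<omega> by (auto simp: T_def)
    qed
    moreover have "selected_length n X \<tau> \<omega> =
        chain_length {k. \<exists>j\<ge>1. \<tau> j \<omega> = enat k} (\<lambda>k. X k \<omega>)"
      using strat \<omega> by (intro selected_length_eq_chain_length) (auto simp: selection_strategy_def)
    ultimately show ?thesis using T_restrict[of "\<lambda>i. X i \<omega>"] by (simp add: f_def)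
  qed
  have "N.expectation (\<lambda>\<omega>. real (selected_length n X \<tau> \<omega>)) = N.expectation (\<lambda>\<omega>. f (?X \<omega>))"
    using len by (intro Bochner_Integration.integral_cong) auto
  also have "\<dots> = integral\<^sup>L (distr N ?B ?X) f"
    using f_meas rv by (intro integral_distr[symmetric] measurable_restrict) auto
  also have "\<dots> = integral\<^sup>L ?P f"
    unfolding distr ..
  also have "\<dots> \<le> s_perm M n \<pi>"
  proof (rule expectation_le_of_sum_permutations_le[OF U_prob])
    interpret P: prob_space ?P using U_prob by (intro prob_space_PiM)
    show "integrable ?P f"
    proof (rule P.integrable_const_bound[of _ n])
      show "AE x in ?P. norm (f x) \<le> n"
        using chain_length_le[OF T_sub] by (intro AE_I2) (simp add: f_def)
      show "f \<in> borel_measurable ?P"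
        using f_meas unfolding measurable_cong_sets[OF sets_P refl] .
    qed
    fix x :: "nat \<Rightarrow> real"
    \<comment> \<open>The bound is needed for every fixed vector \<open>x\<close>, and the sorting
      argument gives it for each.\<close>
    have "(\<Sum>p | p permutes {1..n}. f (\<lambda>i\<in>{1..n}. x (p i))) =
        (\<Sum>p | p permutes {1..n}. real (chain_length (T (x \<circ> p)) (x \<circ> p)))"
      using T_restrict by (simp add: f_def comp_def)
    also have "\<dots> \<le> fact n * s_perm M n \<pi>"
      using assms(2) T_sub by (rule sum_permuted_chain_length_le_s_perm) (rule T_adapted, auto)
    finally show "(\<Sum>p | p permutes {1..n}. f (\<lambda>i\<in>{1..n}. x (p i))) \<le> fact n * s_perm M n \<pi>" .
  qed
  finally show "N.expectation (\<lambda>\<omega>. real (selected_length n X \<tau> \<omega>)) \<le> s_perm M n \<pi>" .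
qed

end
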